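(* Fix an integer $p\ge 2$. For any real $\beta_1,\beta_2$, as $n\to\infty$, $$\psi_n(\beta_1,\beta_2)=\max_{x\in[0,1]}\ell(x)+O(n^{-1}\log n).$$
   Context: For $n\ge 1$, a directed graph (loops allowed, no duplicate edges) on $n$ nodes is identified with its adjacency matrix $X=(X_{ij})_{1\le i,j\le n}\in\{0,1\}^{n\times n}$. Set $$e(X)=n^{-2}\sum_{1\le i,j\le n}X_{ij},\qquad s(X)=n^{-p-1}\sum_{1\le i,j_1,\dots,j_p\le n}X_{ij_1}X_{ij_2}\cdots X_{ij_p}.$$ The normalization constant is $Z_n(\beta_1,\beta_2)=\sum_{X\in\{0,1\}^{n\times n}}\exp[n^2(\beta_1e(X)+\beta_2s(X))]$ and $\psi_n(\beta_1,\beta_2)=n^{-2}\log Z_n(\beta_1,\beta_2)$. The function $\ell:[0,1]\to\mathbb{R}$ is $\ell(x)=\beta_1x+\beta_2x^p-x\log x-(1-x)\log(1-x)$, with the convention $0\log 0=0$. The implied constant in $O(\cdot)$ may depend on $p,\beta_1,\beta_2$ but not on $n$. *)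

theory Defs
  imports "HOL-Analysis.Analysis" "HOL-Library.Landau_Symbols"
begin

text \<open>Directed graphs on the nodes \<open>1, \<dots>, n\<close> (loops allowed) are their 0-1 adjacency matrices.
  Functions are extensional, so that each matrix is represented exactly once.\<close>

definition digraphs :: "nat \<Rightarrow> (nat \<Rightarrow> nat \<Rightarrow> real) set" where
  "digraphs n = {1..n} \<rightarrow>\<^sub>E {1..n} \<rightarrow>\<^sub>E {0, 1}"

definition edge_density :: "nat \<Rightarrow> (nat \<Rightarrow> nat \<Rightarrow> real) \<Rightarrow> real" where
  "edge_density n X = (\<Sum>i = 1..n. \<Sum>j = 1..n. X i j) / real n ^ 2"

text \<open>The index tuple \<open>(j\<^sub>1, \<dots>, j\<^sub>p)\<close> is a function \<open>j\<close> from \<open>{1..p}\<close> to \<open>{1..n}\<close>.\<close>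

definition star_density :: "nat \<Rightarrow> nat \<Rightarrow> (nat \<Rightarrow> nat \<Rightarrow> real) \<Rightarrow> real" where
  "star_density p n X =
     (\<Sum>i = 1..n. \<Sum>j \<in> {1..p} \<rightarrow>\<^sub>E {1..n}. \<Prod>k = 1..p. X i (j k)) / real n ^ (p + 1)"

definition partition_fun :: "nat \<Rightarrow> real \<Rightarrow> real \<Rightarrow> nat \<Rightarrow> real" where
  "partition_fun p \<beta>\<^sub>1 \<beta>\<^sub>2 n =
     (\<Sum>X \<in> digraphs n. exp (real n ^ 2 * (\<beta>\<^sub>1 * edge_density n X + \<beta>\<^sub>2 * star_density p n X)))"

definition psi :: "nat \<Rightarrow> real \<Rightarrow> real \<Rightarrow> nat \<Rightarrow> real" where
  "psi p \<beta>\<^sub>1 \<beta>\<^sub>2 n = ln (partition_fun p \<beta>\<^sub>1 \<beta>\<^sub>2 n) / real n ^ 2"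

text \<open>The convention \<open>0 log 0 = 0\<close> is automatic, since the product with \<open>0\<close> vanishes.\<close>

definition ell :: "nat \<Rightarrow> real \<Rightarrow> real \<Rightarrow> real \<Rightarrow> real" where
  "ell p \<beta>\<^sub>1 \<beta>\<^sub>2 x = \<beta>\<^sub>1 * x + \<beta>\<^sub>2 * x ^ p - x * ln x - (1 - x) * ln (1 - x)"

end

theory Submission
  imports Defs "HOL-Real_Asymp.Real_Asymp"
begin

text \<open>The exponent \<open>n\<^sup>2 (\<beta>\<^sub>1 e(X) + \<beta>\<^sub>2 s(X))\<close> is a sum over the rows of \<open>X\<close> of a function of the
  row sum, so the partition function is the \<open>n\<close>-th power of
  \<open>\<Sum>d\<le>n. (n choose d) exp (n (\<beta>\<^sub>1 d/n + \<beta>\<^sub>2 (d/n)\<^sup>p))\<close>. Each of its \<open>n + 1\<close> terms is at most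
  \<open>exp (n \<ell>(d/n))\<close>, because a binomial probability is at most 1. For the lower bound, tilt the
  sum to the binomial law of parameter \<open>x\<close> and apply Jensen's inequality to the exponential: since
  the binomial variance is \<open>n x (1 - x)\<close>, this gives \<open>exp (n \<ell>(x) - O(1))\<close> for every \<open>x\<close>,
  in particular at a maximizer, with no need for Stirling's formula.\<close>

section \<open>Factorization of the partition function\<close>

text \<open>A 0-1 vector is the indicator of a subset of \<open>A\<close>, and its entry sum is the
  cardinality; grouping subsets by size produces the binomial coefficients.\<close>

lemma sum_PiE_01_eq_sum_binomial:
  fixes h :: "real \<Rightarrow> real"
  assumes "finite A"
  shows "(\<Sum>r \<in> A \<rightarrow>\<^sub>E {0, 1}. h (\<Sum>j\<in>A. r j)) = (\<Sum>d\<le>card A. real (card A choose d) * h (real d))"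
proof -
  have "(\<Sum>r \<in> A \<rightarrow>\<^sub>E {0, 1}. h (\<Sum>j\<in>A. r j)) = (\<Sum>S \<in> Pow A. h (real (card S)))"
  proof (rule sum.reindex_bij_witness[where
        j = "\<lambda>r. {j\<in>A. r j = 1}" and i = "\<lambda>S. restrict (\<lambda>j. if j \<in> S then 1 else 0) A"])
    fix r :: "'a \<Rightarrow> real" assume r: "r \<in> A \<rightarrow>\<^sub>E {0, 1}"
    show "restrict (\<lambda>j. if j \<in> {j \<in> A. r j = 1} then 1 else 0) A = r"
      using r by (auto simp: fun_eq_iff PiE_iff restrict_def extensional_def)
    have "(\<Sum>j\<in>A. r j) = (\<Sum>j\<in>A. if r j = 1 then 1 else 0)"
      using r by (intro sum.cong) auto
    then show "h (real (card {j \<in> A. r j = 1})) = h (\<Sum>j\<in>A. r j)"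
      using assms by (simp add: sum.If_cases Int_def)
  qed auto
  also have "\<dots> = (\<Sum>d\<le>card A. \<Sum>S | S \<in> Pow A \<and> card S = d. h (real (card S)))"
    using assms by (intro sum.group[symmetric]) (auto intro: card_mono)
  also have "\<dots> = (\<Sum>d\<le>card A. real (card A choose d) * h (real d))"
    using assms by (intro sum.cong) (simp_all add: n_subsets)
  finally show ?thesis .
qed

text \<open>Partition function of a single row, with its 0-1 patterns grouped by out-degree
  \<open>d\<close>.\<close>

definition row_sum :: "nat \<Rightarrow> real \<Rightarrow> real \<Rightarrow> nat \<Rightarrow> real" where
  "row_sum p \<beta>\<^sub>1 \<beta>\<^sub>2 n =
     (\<Sum>d\<le>n. real (n choose d) * exp (real n * (\<beta>\<^sub>1 * (real d / n) + \<beta>\<^sub>2 * (real d / n) ^ p)))"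

lemma partition_fun_eq_row_sum_power:
  assumes "n > 0"
  shows "partition_fun p \<beta>\<^sub>1 \<beta>\<^sub>2 n = row_sum p \<beta>\<^sub>1 \<beta>\<^sub>2 n ^ n"
proof -
  define h where "h s = exp (real n * (\<beta>\<^sub>1 * (s / n) + \<beta>\<^sub>2 * (s / n) ^ p))" for s :: real
  have star: "star_density p n X = (\<Sum>i = 1..n. (\<Sum>j = 1..n. X i j) ^ p) / real n ^ (p + 1)" for X
  proof -
    \<comment> \<open>Distributivity read backwards: the sum over all tuples \<open>j\<close> is the
      fully expanded \<open>p\<close>-th power of the row sum.\<close>
    have "(\<Sum>j \<in> {1..p} \<rightarrow>\<^sub>E {1..n}. \<Prod>k = 1..p. X i (j k)) = (\<Sum>j = 1..n. X i j) ^ p" for i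
      by (subst prod_sum_PiE[symmetric]) auto
    then show ?thesis unfolding star_density_def by simp
  qed
  have "exp (real n ^ 2 * (\<beta>\<^sub>1 * edge_density n X + \<beta>\<^sub>2 * star_density p n X)) =
      (\<Prod>i = 1..n. h (\<Sum>j = 1..n. X i j))" for X
  proof -
    have "real n ^ 2 * (\<beta>\<^sub>1 * edge_density n X + \<beta>\<^sub>2 * star_density p n X) =
        \<beta>\<^sub>1 * (\<Sum>i = 1..n. \<Sum>j = 1..n. X i j) +
        real n * \<beta>\<^sub>2 / real n ^ p * (\<Sum>i = 1..n. (\<Sum>j = 1..n. X i j) ^ p)"
      unfolding star edge_density_def using assms by (simp add: field_simps power2_eq_square)
    also have "\<dots> = (\<Sum>i = 1..n. real n * (\<beta>\<^sub>1 * ((\<Sum>j = 1..n. X i j) / n) +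
        \<beta>\<^sub>2 * ((\<Sum>j = 1..n. X i j) / n) ^ p))"
      unfolding sum_distrib_left sum.distrib[symmetric]
      using assms by (intro sum.cong) (simp_all add: field_simps power_divide sum_distrib_left)
    finally show ?thesis unfolding h_def by (simp add: exp_sum)
  qed
  then have "partition_fun p \<beta>\<^sub>1 \<beta>\<^sub>2 n = (\<Sum>X \<in> digraphs n. \<Prod>i = 1..n. h (\<Sum>j = 1..n. X i j))"
    unfolding partition_fun_def by simp
  also have "\<dots> = (\<Prod>i = 1..n. \<Sum>r \<in> {1..n} \<rightarrow>\<^sub>E {0, 1}. h (\<Sum>j = 1..n. r j))"
    unfolding digraphs_def by (intro prod_sum_PiE[symmetric]) (auto intro: finite_PiE)
  also have "\<dots> = row_sum p \<beta>\<^sub>1 \<beta>\<^sub>2 n ^ n"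
    by (subst sum_PiE_01_eq_sum_binomial) (simp_all add: row_sum_def h_def)
  finally show ?thesis .
qed

lemma row_sum_pos: "row_sum p \<beta>\<^sub>1 \<beta>\<^sub>2 n > 0"
  unfolding row_sum_def by (intro sum_pos) auto

lemma psi_eq_ln_row_sum:
  assumes "n > 0"
  shows "psi p \<beta>\<^sub>1 \<beta>\<^sub>2 n = ln (row_sum p \<beta>\<^sub>1 \<beta>\<^sub>2 n) / n"
  using assms row_sum_pos[of p \<beta>\<^sub>1 \<beta>\<^sub>2 n]
  by (simp add: psi_def partition_fun_eq_row_sum_power ln_realpow power2_eq_square)

section \<open>Upper bound\<close>

text \<open>The right side is the reciprocal of \<open>x ^ d * (1 - x) ^ (n - d)\<close>, so for 0 <
  d < n the claim is that the binomial law of parameter \<open>d / n\<close> gives the point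
  \<open>d\<close> mass at most 1. For \<open>d = 0\<close> and \<open>d = n\<close> both sides
  equal 1.\<close>

lemma binomial_le_exp_entropy:
  assumes "d \<le> n" "n > 0"
  defines "x \<equiv> real d / n"
  shows "real (n choose d) \<le> exp (real n * (- x * ln x - (1 - x) * ln (1 - x)))"
proof (cases "d = 0 \<or> d = n")
  case True
  then show ?thesis using assms by auto
next
  case False
  then have x: "0 < x" "x < 1" using assms by auto
  have "Bernstein n d x \<le> (\<Sum>k\<le>n. Bernstein n k x)"
    using assms x by (intro member_le_sum) (auto intro: Bernstein_nonneg)
  then have "real (n choose d) * (x ^ d * (1 - x) ^ (n - d)) \<le> 1"
    unfolding sum_Bernstein by (simp add: Bernstein_def mult.assoc)
  moreover have "x ^ d * (1 - x) ^ (n - d) = exp (real n * (x * ln x + (1 - x) * ln (1 - x)))"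
  proof -
    have "x ^ d * (1 - x) ^ (n - d) = exp (real d * ln x + real (n - d) * ln (1 - x))"
      using x by (simp add: exp_add exp_of_nat_mult)
    also have "real d * ln x + real (n - d) * ln (1 - x) = real n * (x * ln x + (1 - x) * ln (1 - x))"
      using assms by (simp add: field_simps of_nat_diff)
    finally show ?thesis .
  qed
  ultimately show ?thesis
    by (simp add: exp_minus field_simps right_diff_distrib distrib_left exp_diff exp_add)
qed

text \<open>The term \<open>ln (real n + 1)\<close> only counts the summands of
  \<open>row_sum\<close>; it is the source of the logarithm in the final error.\<close>

lemma ln_row_sum_le:
  assumes "n > 0" and M: "\<And>x. x \<in> {0..1} \<Longrightarrow> ell p \<beta>\<^sub>1 \<beta>\<^sub>2 x \<le> M"
  shows "ln (row_sum p \<beta>\<^sub>1 \<beta>\<^sub>2 n) \<le> n * M + ln (real n + 1)"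
proof -
  have "row_sum p \<beta>\<^sub>1 \<beta>\<^sub>2 n \<le> (\<Sum>d\<le>n. exp (n * M))"
    unfolding row_sum_def
  proof (intro sum_mono)
    fix d assume "d \<in> {..n}"
    then have d: "d \<le> n" by simp
    define x where "x = real d / n"
    have x: "x \<in> {0..1}" using d assms(1) by (auto simp: x_def)
    have "real (n choose d) * exp (n * (\<beta>\<^sub>1 * x + \<beta>\<^sub>2 * x ^ p)) \<le>
        exp (real n * (- x * ln x - (1 - x) * ln (1 - x))) * exp (n * (\<beta>\<^sub>1 * x + \<beta>\<^sub>2 * x ^ p))"
      using binomial_le_exp_entropy[OF d assms(1)] by (intro mult_right_mono) (simp_all add: x_def)
    also have "\<dots> = exp (n * ell p \<beta>\<^sub>1 \<beta>\<^sub>2 x)"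
      unfolding exp_add[symmetric] ell_def by (simp add: algebra_simps)
    also have "\<dots> \<le> exp (n * M)"
      using M[OF x] by (simp add: mult_left_mono)
    finally show "real (n choose d) * exp (n * (\<beta>\<^sub>1 * (real d / n) + \<beta>\<^sub>2 * (real d / n) ^ p)) \<le> exp (n * M)"
      by (simp add: x_def)
  qed
  also have "\<dots> = exp (n * M + ln (real n + 1))"
    by (simp add: exp_add algebra_simps)
  finally have "ln (row_sum p \<beta>\<^sub>1 \<beta>\<^sub>2 n) \<le> ln (exp (n * M + ln (real n + 1)))"
    using row_sum_pos by (subst ln_le_cancel_iff) auto
  then show ?thesis by simp
qed

section \<open>Lower bound\<close>

text \<open>Jensen's inequality for \<open>exp\<close>: average the tangent-line bound at the mean
  \<open>m\<close>, whose linear part has mean zero.\<close>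

lemma exp_sum_le_sum_exp:
  fixes a y :: "'a \<Rightarrow> real"
  assumes "\<And>i. i \<in> A \<Longrightarrow> 0 \<le> a i" "sum a A = 1"
  shows "exp (\<Sum>i\<in>A. a i * y i) \<le> (\<Sum>i\<in>A. a i * exp (y i))"
proof -
  define m where "m = (\<Sum>i\<in>A. a i * y i)"
  have "a i * (exp m * (1 + (y i - m))) = exp m * ((1 - m) * a i + a i * y i)" for i
    by (simp add: algebra_simps)
  then have "(\<Sum>i\<in>A. a i * (exp m * (1 + (y i - m)))) = exp m * ((1 - m) * sum a A + m)"
    by (simp only: sum.distrib sum_distrib_left[symmetric] m_def[symmetric])
  then have "exp m = (\<Sum>i\<in>A. a i * (exp m * (1 + (y i - m))))"
    using assms(2) by simp
  also have "\<dots> \<le> (\<Sum>i\<in>A. a i * exp (y i))"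
  proof (intro sum_mono mult_left_mono assms(1))
    fix i
    have "exp m * (1 + (y i - m)) \<le> exp m * exp (y i - m)"
      by (intro mult_left_mono exp_ge_add_one_self) auto
    then show "exp m * (1 + (y i - m)) \<le> exp (y i)" by (simp flip: exp_add)
  qed
  finally show ?thesis by (simp add: m_def)
qed

text \<open>Under a law with mean \<open>x\<close> the linear term averages to zero and the
  quadratic one to a variance. The crude constant \<open>p ^ 2\<close> suits the induction, as p^2 +
  p is at most (p + 1)^2.\<close>

lemma power_Taylor_bound:
  fixes x y :: real
  assumes "x \<in> {0..1}" "y \<in> {0..1}"
  shows "\<bar>y ^ p - x ^ p - p * x ^ (p - 1) * (y - x)\<bar> \<le> p ^ 2 * (y - x) ^ 2"
proof (induction p)
  case (Suc p)
  define r where "r = y ^ p - x ^ p - p * x ^ (p - 1) * (y - x)"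
  have "y ^ Suc p - x ^ Suc p - Suc p * x ^ (Suc p - 1) * (y - x)
      = y * r + p * x ^ (p - 1) * (y - x) ^ 2"
    \<comment> \<open>For \<open>p = 0\<close> the exponent \<open>p - 1\<close> is truncated, but
      its coefficient \<open>p\<close> vanishes.\<close>
    by (cases p) (simp_all add: r_def algebra_simps power2_eq_square)
  also have "\<bar>\<dots>\<bar> \<le> \<bar>y * r\<bar> + \<bar>p * x ^ (p - 1) * (y - x) ^ 2\<bar>" by (rule abs_triangle_ineq)
  also have "\<bar>y * r\<bar> \<le> 1 * (p ^ 2 * (y - x) ^ 2)"
    unfolding abs_mult using Suc.IH assms by (intro mult_mono) (auto simp: r_def)
  also have "\<bar>p * x ^ (p - 1) * (y - x) ^ 2\<bar> \<le> p * 1 * (y - x) ^ 2"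
    unfolding abs_mult using assms by (intro mult_mono) (auto simp: power_le_one intro: mult_left_le)
  also have "1 * (p ^ 2 * (y - x) ^ 2) + p * 1 * (y - x) ^ 2 = real (p ^ 2 + p) * (y - x) ^ 2"
    by (simp add: algebra_simps)
  also have "\<dots> \<le> real (Suc p ^ 2) * (y - x) ^ 2"
    by (intro mult_right_mono) (auto simp: power2_eq_square)
  finally show ?case by simp
qed auto

lemma sum_Bernstein_variance:
  assumes "n > 0"
  shows "(\<Sum>k\<le>n. Bernstein n k x * (real k / n - x) ^ 2) = x * (1 - x) / n"
proof -
  \<comment> \<open>Expand in the factorial moments k(k - 1), k and 1, whose Bernstein sums are
    known.\<close>
  have "Bernstein n k x * (real k / n - x) ^ 2 =
      (real k * (real k - 1) * Bernstein n k x + (1 - 2 * (n * x)) * (real k * Bernstein n k x)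
        + (n * x) ^ 2 * Bernstein n k x) / n ^ 2" for k
    using assms by (simp add: field_simps power2_eq_square)
  then have "(\<Sum>k\<le>n. Bernstein n k x * (real k / n - x) ^ 2) =
      (real n * (real n - 1) * x\<^sup>2 + (1 - 2 * (n * x)) * (n * x) + (n * x) ^ 2) / n ^ 2"
    by (simp add: sum.distrib flip: sum_divide_distrib sum_distrib_left)
  also have "\<dots> = x * (1 - x) / n"
    using assms by (simp add: field_simps power2_eq_square)
  finally show ?thesis .
qed

lemma sum_Bernstein_mean:
  assumes "n > 0"
  shows "(\<Sum>k\<le>n. Bernstein n k x * (real k / n)) = x"
proof -
  have "(\<Sum>k\<le>n. Bernstein n k x * (real k / n)) = (\<Sum>k\<le>n. real k * Bernstein n k x) / n"
    unfolding sum_divide_distrib by (intro sum.cong) simp_all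
  then show ?thesis using assms by simp
qed

text \<open>Taylor expansion about the mean \<open>x\<close>: the first-order term cancels, and the
  remainder is at most \<open>p ^ 2\<close> times the variance
  \<open>x * (1 - x) / n\<close>.\<close>

lemma sum_Bernstein_power_approx:
  assumes "n > 0" "x \<in> {0..1}"
  shows "\<bar>(\<Sum>k\<le>n. Bernstein n k x * (real k / n) ^ p) - x ^ p\<bar> \<le> p ^ 2 / n"
proof -
  define r where "r k = (real k / n) ^ p - x ^ p - p * x ^ (p - 1) * (real k / n - x)" for k
  have r: "Bernstein n k x * (real k / n) ^ p = Bernstein n k x * x ^ p
      + p * x ^ (p - 1) * (Bernstein n k x * (real k / n) - x * Bernstein n k x)
      + Bernstein n k x * r k" for k
    by (simp add: r_def algebra_simps)
  have "(\<Sum>k\<le>n. Bernstein n k x * (real k / n) ^ p) - x ^ p = (\<Sum>k\<le>n. Bernstein n k x * r k)"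
    unfolding r sum.distrib sum_subtractf sum_distrib_left[symmetric] sum_distrib_right[symmetric]
      sum_Bernstein sum_Bernstein_mean[OF assms(1)] by simp
  also have "\<bar>\<dots>\<bar> \<le> (\<Sum>k\<le>n. \<bar>Bernstein n k x * r k\<bar>)" by (rule sum_abs)
  also have "\<dots> \<le> (\<Sum>k\<le>n. Bernstein n k x * (p ^ 2 * (real k / n - x) ^ 2))"
  proof (intro sum_mono)
    fix k assume k: "k \<in> {..n}"
    have "\<bar>r k\<bar> \<le> p ^ 2 * (real k / n - x) ^ 2"
      using power_Taylor_bound[of x "real k / n" p] assms k by (simp add: r_def)
    then show "\<bar>Bernstein n k x * r k\<bar> \<le> Bernstein n k x * (p ^ 2 * (real k / n - x) ^ 2)"
      using assms(2) Bernstein_nonneg[of x n k] by (auto simp: abs_mult intro: mult_left_mono)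
  qed
  also have "\<dots> = p ^ 2 * (x * (1 - x) / n)"
    unfolding sum_Bernstein_variance[OF assms(1), symmetric] sum_distrib_left
    by (intro sum.cong) simp_all
  also have "\<dots> \<le> p ^ 2 * (1 / n)"
    using assms by (intro mult_left_mono divide_right_mono mult_le_one) auto
  finally show ?thesis by simp
qed

lemma ln_row_sum_ge:
  assumes "n > 0" "p > 0" "x \<in> {0..1}"
  shows "n * ell p \<beta>\<^sub>1 \<beta>\<^sub>2 x - \<bar>\<beta>\<^sub>2\<bar> * p ^ 2 \<le> ln (row_sum p \<beta>\<^sub>1 \<beta>\<^sub>2 n)"
proof -
  define g where "g d = real n * (\<beta>\<^sub>1 * (real d / n) + \<beta>\<^sub>2 * (real d / n) ^ p)" for d
  have "exp (n * ell p \<beta>\<^sub>1 \<beta>\<^sub>2 x - \<bar>\<beta>\<^sub>2\<bar> * p ^ 2) \<le> row_sum p \<beta>\<^sub>1 \<beta>\<^sub>2 n"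
  \<comment> \<open>At an endpoint the binomial law is a point mass and tilting would need
    \<open>ln 0\<close>; the single summand \<open>d = 0\<close> or \<open>d = n\<close>
    suffices.\<close>
  proof (cases "x = 0 \<or> x = 1")
    case True
    define d where "d = (if x = 0 then 0 else n)"
    have "exp (n * ell p \<beta>\<^sub>1 \<beta>\<^sub>2 x - \<bar>\<beta>\<^sub>2\<bar> * p ^ 2) \<le> exp (n * ell p \<beta>\<^sub>1 \<beta>\<^sub>2 x)"
      by simp
    also have "\<dots> = real (n choose d) * exp (g d)"
      using True assms by (auto simp: d_def ell_def g_def)
    also have "\<dots> \<le> row_sum p \<beta>\<^sub>1 \<beta>\<^sub>2 n"
      unfolding row_sum_def g_def by (rule member_le_sum) (auto simp: d_def)
    finally show ?thesis .
  next
    case False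
    with assms have x: "0 < x" "x < 1" by auto
    \<comment> \<open>Log-probability of one particular row with \<open>d\<close> ones. Writing
      \<open>real n - real d\<close> makes \<open>H\<close> affine in \<open>d\<close>, so its mean
      under the binomial law depends only on the mean of \<open>d\<close>.\<close>
    define H where "H d = real d * ln x + (real n - real d) * ln (1 - x)" for d
    have H: "x ^ d * (1 - x) ^ (n - d) = exp (H d)" if "d \<le> n" for d
    proof -
      have "H d = real d * ln x + real (n - d) * ln (1 - x)"
        using that by (simp add: H_def of_nat_diff)
      then show ?thesis using x by (simp add: exp_add exp_of_nat_mult)
    qed
    \<comment> \<open>The tilt: moving \<open>exp (H d)\<close> into the weight turns the binomial
      coefficient into a binomial probability.\<close>
    have "row_sum p \<beta>\<^sub>1 \<beta>\<^sub>2 n = (\<Sum>d\<le>n. Bernstein n d x * exp (g d - H d))"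
      unfolding row_sum_def g_def[symmetric] Bernstein_def mult.assoc
    proof (intro sum.cong refl arg_cong[where f = "(*) _"])
      fix d assume "d \<in> {..n}"
      then show "exp (g d) = x ^ d * ((1 - x) ^ (n - d) * exp (g d - H d))"
        using H[of d] by (simp add: exp_diff flip: mult.assoc)
    qed
    moreover have "exp (\<Sum>d\<le>n. Bernstein n d x * (g d - H d)) \<le>
        (\<Sum>d\<le>n. Bernstein n d x * exp (g d - H d))"
      using x by (intro exp_sum_le_sum_exp) (auto intro: Bernstein_nonneg)
    moreover have "n * ell p \<beta>\<^sub>1 \<beta>\<^sub>2 x - \<bar>\<beta>\<^sub>2\<bar> * p ^ 2 \<le> (\<Sum>d\<le>n. Bernstein n d x * (g d - H d))"
    proof -
      define E where "E = (\<Sum>d\<le>n. Bernstein n d x * (real d / n) ^ p)"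
      \<comment> \<open>\<open>c\<close> collects the coefficients of \<open>d / n\<close> in
        \<open>g d - H d\<close>. This affine part averages exactly, so the only error is that of
        replacing the mean \<open>E\<close> by \<open>x ^ p\<close>.\<close>
      define c where "c = real n * (\<beta>\<^sub>1 - ln x + ln (1 - x))"
      have "Bernstein n d x * (g d - H d) = c * (Bernstein n d x * (real d / n))
          + n * \<beta>\<^sub>2 * (Bernstein n d x * (real d / n) ^ p) - n * ln (1 - x) * Bernstein n d x" for d
        using assms(1) by (simp add: g_def H_def c_def algebra_simps)
      then have "(\<Sum>d\<le>n. Bernstein n d x * (g d - H d)) = c * x + n * \<beta>\<^sub>2 * E - n * ln (1 - x)"
        by (simp only: sum.distrib sum_subtractf E_def sum_distrib_left[symmetric]
            sum_Bernstein_mean[OF assms(1)] sum_Bernstein mult_1_right)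
      also have "\<dots> = n * ell p \<beta>\<^sub>1 \<beta>\<^sub>2 x + n * (\<beta>\<^sub>2 * (E - x ^ p))"
        by (simp add: ell_def c_def algebra_simps)
      finally have eq: "(\<Sum>d\<le>n. Bernstein n d x * (g d - H d)) =
        n * ell p \<beta>\<^sub>1 \<beta>\<^sub>2 x + n * (\<beta>\<^sub>2 * (E - x ^ p))" .
      have "\<bar>n * (\<beta>\<^sub>2 * (E - x ^ p))\<bar> \<le> n * (\<bar>\<beta>\<^sub>2\<bar> * (p ^ 2 / n))"
        unfolding abs_mult using sum_Bernstein_power_approx[OF assms(1,3), of p]
        by (intro mult_mono) (auto simp: E_def)
      also have "\<dots> = \<bar>\<beta>\<^sub>2\<bar> * p ^ 2" using assms(1) by simp
      finally show ?thesis unfolding eq by linarith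
    qed
    ultimately show ?thesis
      by (smt (verit) exp_le_cancel_iff)
  qed
  then show ?thesis using row_sum_pos[of p \<beta>\<^sub>1 \<beta>\<^sub>2 n] by (simp add: ln_ge_iff)
qed

section \<open>The maximum\<close>

text \<open>At 0 the one-sided limit 0 agrees with the value, since \<open>0 * ln 0 = 0\<close>.
  This makes \<open>ell\<close> continuous on the closed interval, so its maximum is
  attained.\<close>

lemma continuous_on_x_ln_x: "continuous_on {0..} (\<lambda>x::real. x * ln x)"
  unfolding continuous_on_eq_continuous_within
proof
  fix a :: real assume "a \<in> {0..}"
  then consider "a = 0" | "a > 0" by force
  then show "continuous (at a within {0..}) (\<lambda>x. x * ln x)"
  proof cases
    case 1
    have "((\<lambda>x::real. x * ln x) \<longlongrightarrow> 0) (at_right 0)" by real_asymp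
    then show ?thesis using 1 by (simp add: continuous_within at_within_Ici_at_right)
  next
    case 2
    then show ?thesis by (intro continuous_intros) auto
  qed
qed

lemma continuous_on_ell: "continuous_on {0..1} (ell p \<beta>\<^sub>1 \<beta>\<^sub>2)"
  unfolding ell_def[abs_def]
  by (intro continuous_intros continuous_on_subset[OF continuous_on_x_ln_x]
      continuous_on_compose2[OF continuous_on_x_ln_x, of _ "\<lambda>x. 1 - x"]) auto

theorem theorem1:
  fixes p :: nat and \<beta>\<^sub>1 \<beta>\<^sub>2 :: real
  assumes "p \<ge> 2"
  shows "\<exists>x\<^sub>0. is_arg_max (ell p \<beta>\<^sub>1 \<beta>\<^sub>2) (\<lambda>x. x \<in> {0..1}) x\<^sub>0 \<and>
    (\<lambda>n. psi p \<beta>\<^sub>1 \<beta>\<^sub>2 n - ell p \<beta>\<^sub>1 \<beta>\<^sub>2 x\<^sub>0) \<in> O(\<lambda>n. ln (real n) / real n)"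
proof -
  obtain x\<^sub>0 where x0: "x\<^sub>0 \<in> {0..1}"
    and max: "\<And>y. y \<in> {0..1} \<Longrightarrow> ell p \<beta>\<^sub>1 \<beta>\<^sub>2 y \<le> ell p \<beta>\<^sub>1 \<beta>\<^sub>2 x\<^sub>0"
    using continuous_attains_sup[OF _ _ continuous_on_ell[of p \<beta>\<^sub>1 \<beta>\<^sub>2]] by auto
  define M where "M = ell p \<beta>\<^sub>1 \<beta>\<^sub>2 x\<^sub>0"
  define C where "C = \<bar>\<beta>\<^sub>2\<bar> * p ^ 2"
  \<comment> \<open>\<open>C\<close> comes from the lower bound and \<open>ln (real n + 1)\<close>
    from the upper one. Their sum bounds both deviations for every positive \<open>n\<close>, and
    the constant is absorbed by the logarithm asymptotically.\<close>
  have "(\<lambda>n. psi p \<beta>\<^sub>1 \<beta>\<^sub>2 n - M) \<in> O(\<lambda>n. (C + ln (real n + 1)) / n)"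
  proof (rule landau_o.bigI[of 1])
    show "\<forall>\<^sub>F n in sequentially. norm (psi p \<beta>\<^sub>1 \<beta>\<^sub>2 n - M) \<le> 1 * norm ((C + ln (real n + 1)) / n)"
      using eventually_gt_at_top[of 0]
    proof eventually_elim
      case (elim n)
      let ?L = "ln (row_sum p \<beta>\<^sub>1 \<beta>\<^sub>2 n)"
      have "?L \<le> n * M + ln (real n + 1)"
        using ln_row_sum_le[OF elim max] by (simp add: M_def)
      moreover have "n * M - C \<le> ?L"
        using ln_row_sum_ge[OF elim _ x0, of p] assms by (simp add: M_def C_def)
      moreover have "C \<ge> 0" "ln (real n + 1) \<ge> 0" by (simp_all add: C_def)
      ultimately have bound: "\<bar>?L - n * M\<bar> \<le> \<bar>C + ln (real n + 1)\<bar>" by linarith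
      have "psi p \<beta>\<^sub>1 \<beta>\<^sub>2 n - M = (?L - n * M) / n"
        using elim by (simp add: psi_eq_ln_row_sum field_simps)
      with bound show ?case by (simp add: divide_right_mono)
    qed
  qed simp
  also have "(\<lambda>n. (C + ln (real n + 1)) / n) \<in> O(\<lambda>n. ln (real n) / real n)"
    by real_asymp
  finally show ?thesis
    using x0 max by (auto simp: is_arg_max_linorder M_def)
qed

end
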